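(* Let $C_0$ and $C_1$ be bivariate copulas on $[0,1]\times[0,1]$ such that $C_0$ is NQD and $C_1$ is PQD. For $\alpha\in[0,1]$ put $C_\alpha(u,v)=(1-\alpha)C_0(u,v)+\alpha C_1(u,v)$. Suppose that the function $$(u,v)\mapsto \frac{uv-C_0(u,v)}{C_1(u,v)-C_0(u,v)},$$ considered at those points $(u,v)\in[0,1]\times[0,1]$ where $C_1(u,v)\neq C_0(u,v)$, is not constant (i.e. it takes at least two distinct values). Then there exist $m,m',M',M\in[0,1]$ with $0\le m\le m'$, $M'\le M\le 1$ and $m<M$ such that: (i) $C_\alpha$ is NQD for all $\alpha\in[0,m]$; (ii) $C_\alpha$ is neither NQD nor PQD for all $\alpha\in(m,M)$; (iii) $C_\alpha$ is PQD for all $\alpha\in[M,1]$; (iv) for $\alpha\in[0,1]$, $C_\alpha$ is NQDE if and only if $\alpha\in[0,m']$; (v) $C_\alpha$ is neither NQDE nor PQDE for all $\alpha\in(m',M')$ (this interval is empty if $m'\ge M'$, which may occur); (vi) for $\alpha\in[0,1]$, $C_\alpha$ is PQDE if and only if $\alpha\in[M',1]$. (The equalities $m=m'$ and $M=M'$ are allowed.)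
   Context: A (bivariate) copula is a function $C:[0,1]^2\to[0,1]$ that is the joint cumulative distribution function, restricted to $[0,1]^2$, of a pair of random variables each uniformly distributed on $[0,1]$. A copula $C$ is PQD (positively quadrant dependent) if $C(u,v)\ge uv$ for all $u,v\in[0,1]$, and NQD (negatively quadrant dependent) if $C(u,v)\le uv$ for all $u,v\in[0,1]$. For a copula $C$ put $\mathcal{C}(v)=\int_0^1\big(C(u,v)-uv\big)\,du$ for $v\in[0,1]$. The copula $C$ is PQDE (positively quadrant dependent in expectation) if $\mathcal{C}(v)\ge 0$ for all $v\in[0,1]$, and NQDE (negatively quadrant dependent in expectation) if $\mathcal{C}(v)\le 0$ for all $v\in[0,1]$. *)

theory Defs
  imports "HOL-Probability.Probability"
begin

text \<open>
  Copulas are functions on the unit square; here they are curried functions on the reals whose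
  values outside the unit square are unconstrained and never used. A definition cannot quantify
  existentially over the type of the sample space, so it is taken to be a probability space
  (with arbitrary sigma-algebra) on pairs of reals. This loses no generality: the joint law of
  two real random variables lives on this type and has the same joint distribution function.
\<close>

definition copula :: "(real \<Rightarrow> real \<Rightarrow> real) \<Rightarrow> bool" where
  "copula C \<longleftrightarrow>
    (\<exists>(P :: (real \<times> real) measure) X Y. prob_space P \<and>
       X \<in> borel_measurable P \<and> Y \<in> borel_measurable P \<and>
       distr P lborel X = uniform_measure lborel {0..1} \<and>
       distr P lborel Y = uniform_measure lborel {0..1} \<and>
       (\<forall>u\<in>{0..1}. \<forall>v\<in>{0..1}. C u v = measure P {\<omega> \<in> space P. X \<omega> \<le> u \<and> Y \<omega> \<le> v}))"

text \<open>
  The dependence notions are plain inequalities on the unit square, so that their negations say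
  that the inequality fails; being a copula is a separate hypothesis.
\<close>

definition PQD :: "(real \<Rightarrow> real \<Rightarrow> real) \<Rightarrow> bool" where
  "PQD C \<longleftrightarrow> (\<forall>u\<in>{0..1}. \<forall>v\<in>{0..1}. C u v \<ge> u * v)"

definition NQD :: "(real \<Rightarrow> real \<Rightarrow> real) \<Rightarrow> bool" where
  "NQD C \<longleftrightarrow> (\<forall>u\<in>{0..1}. \<forall>v\<in>{0..1}. C u v \<le> u * v)"

text \<open>The integrand is continuous for a copula, so the Henstock-Kurzweil integral below is the
  Riemann (and the Lebesgue) integral.\<close>

definition mean_excess :: "(real \<Rightarrow> real \<Rightarrow> real) \<Rightarrow> real \<Rightarrow> real" where
  "mean_excess C v = integral {0..1} (\<lambda>u. C u v - u * v)"

definition PQDE :: "(real \<Rightarrow> real \<Rightarrow> real) \<Rightarrow> bool" where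
  "PQDE C \<longleftrightarrow> (\<forall>v\<in>{0..1}. mean_excess C v \<ge> 0)"

definition NQDE :: "(real \<Rightarrow> real \<Rightarrow> real) \<Rightarrow> bool" where
  "NQDE C \<longleftrightarrow> (\<forall>v\<in>{0..1}. mean_excess C v \<le> 0)"

definition mix :: "(real \<Rightarrow> real \<Rightarrow> real) \<Rightarrow> (real \<Rightarrow> real \<Rightarrow> real) \<Rightarrow> real \<Rightarrow> real \<Rightarrow> real \<Rightarrow> real" where
  "mix C0 C1 \<alpha> = (\<lambda>u v. (1 - \<alpha>) * C0 u v + \<alpha> * C1 u v)"

end

theory Submission imports Defs
begin

text \<open>
  The excess \<open>C\<^sub>\<alpha>(u,v) - uv\<close> and its mean over \<open>u\<close> are affine in \<open>\<alpha>\<close>. Hence each of NQD, PQD,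
  NQDE, PQDE holds on a closed convex set of parameters; the first and third contain \<open>0\<close>, the
  other two contain \<open>1\<close>. A parameter with NQD (PQD) is a lower (upper) bound of the quotient in the
  hypothesis, so a non-constant quotient forces \<open>m < M\<close>.
\<close>

text \<open>Each constraint is closed and convex in \<open>t\<close>, so the solutions in
  \<open>{0..1}\<close> form a compact connected set of reals, that is, a closed interval. The sign
  condition on \<open>b\<close> makes \<open>t = 0\<close> a solution.\<close>

lemma halfspaces_Icc_from_0:
  fixes a b :: "'i \<Rightarrow> real"
  assumes "\<And>i. i \<in> I \<Longrightarrow> 0 \<le> b i"
  obtains m where "m \<in> {0..1}"
    "\<And>t. t \<in> {0..1} \<Longrightarrow> (\<forall>i\<in>I. t * a i \<le> b i) \<longleftrightarrow> t \<in> {0..m}"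
proof -
  define S where "S = {0..1} \<inter> (\<Inter>i\<in>I. {t. t * a i \<le> b i})"
  have "closed {t. t * a i \<le> b i}" for i
    by (intro closed_Collect_le continuous_intros)
  then have "compact S"
    unfolding S_def by (intro compact_Int_closed closed_INT) auto
  moreover have "convex {t. t * a i \<le> b i}" for i
    \<comment> \<open>On the reals \<open>inner\<close> is multiplication, so the constraint is a
      one-dimensional half-space.\<close>
    using convex_halfspace_le[of "a i" "b i"] by (simp add: mult.commute)
  then have "connected S"
    unfolding S_def by (intro convex_connected convex_Int convex_INT) auto
  ultimately obtain l m where S: "S = {l..m}"
    using connected_compact_interval_1 by blast
  \<comment> \<open>Up to here \<open>{l..m}\<close> could be empty; membership of \<open>0\<close>
    excludes this and, as \<open>S\<close> lies in \<open>{0..1}\<close>, pins the left endpoint to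
    \<open>0\<close>.\<close>
  have "0 \<in> S" using assms by (simp add: S_def)
  then have lm: "l \<le> 0" "0 \<le> m" by (auto simp: S)
  then have "l \<in> S" "m \<in> S" by (auto simp: S)
  then have "l = 0" "m \<in> {0..1}" using lm by (auto simp: S_def)
  show thesis
  proof
    show "m \<in> {0..1}" by fact
    show "(\<forall>i\<in>I. t * a i \<le> b i) \<longleftrightarrow> t \<in> {0..m}" if "t \<in> {0..1}" for t
    proof -
      have "(\<forall>i\<in>I. t * a i \<le> b i) \<longleftrightarrow> t \<in> S" using that by (simp add: S_def)
      then show ?thesis by (simp add: S \<open>l = 0\<close>)
    qed
  qed
qed

text \<open>The mirror image of the preceding lemma: the reflection of \<open>t\<close> to
  \<open>1 - t\<close> turns a family of constraints satisfied at \<open>1\<close> into one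
  satisfied at \<open>0\<close>.\<close>

lemma halfspaces_Icc_to_1:
  fixes a b :: "'i \<Rightarrow> real"
  assumes "\<And>i. i \<in> I \<Longrightarrow> b i \<le> a i"
  obtains M where "M \<in> {0..1}"
    "\<And>t. t \<in> {0..1} \<Longrightarrow> (\<forall>i\<in>I. b i \<le> t * a i) \<longleftrightarrow> t \<in> {M..1}"
proof -
  have "\<And>i. i \<in> I \<Longrightarrow> 0 \<le> a i - b i" using assms by simp
  then obtain m where m: "m \<in> {0..1}"
    "\<And>t. t \<in> {0..1} \<Longrightarrow> (\<forall>i\<in>I. t * a i \<le> a i - b i) \<longleftrightarrow> t \<in> {0..m}"
    using halfspaces_Icc_from_0[of I "\<lambda>i. a i - b i" a] by blast
  show thesis
  proof
    show "1 - m \<in> {0..1}" using m(1) by simp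
    fix t :: real assume t: "t \<in> {0..1}"
    have "(\<forall>i\<in>I. b i \<le> t * a i) \<longleftrightarrow> (\<forall>i\<in>I. (1 - t) * a i \<le> a i - b i)"
      by (simp add: algebra_simps)
    also have "\<dots> \<longleftrightarrow> 1 - t \<in> {0..m}" using t by (intro m(2)) simp
    also have "\<dots> \<longleftrightarrow> t \<in> {1 - m..1}" by auto
    finally show "(\<forall>i\<in>I. b i \<le> t * a i) \<longleftrightarrow> t \<in> {1 - m..1}" .
  qed
qed

text \<open>The event whose probability is \<open>C u v\<close> grows with \<open>u\<close>.
  Monotonicity is what yields integrability in \<open>u\<close> below.\<close>

lemma copula_mono_on:
  assumes "copula C" and v: "v \<in> {0..1}"
  shows "mono_on {0..1} (\<lambda>u. C u v)"
proof -
  obtain P :: "(real \<times> real) measure" and X Y where P: "prob_space P"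
    and [measurable]: "X \<in> borel_measurable P" "Y \<in> borel_measurable P"
    and C: "\<forall>u\<in>{0..1}. \<forall>v\<in>{0..1}. C u v = measure P {\<omega> \<in> space P. X \<omega> \<le> u \<and> Y \<omega> \<le> v}"
    using assms(1) unfolding copula_def by blast
  interpret prob_space P by (rule P)
  show ?thesis
  proof (rule mono_onI)
    fix r s :: real assume rs: "r \<in> {0..1}" "s \<in> {0..1}" "r \<le> s"
    have "measure P {\<omega> \<in> space P. X \<omega> \<le> r \<and> Y \<omega> \<le> v} \<le> measure P {\<omega> \<in> space P. X \<omega> \<le> s \<and> Y \<omega> \<le> v}"
      by (rule finite_measure_mono) (use rs in auto)
    then show "C r v \<le> C s v" using C rs v by simp
  qed
qed

lemma copula_excess_integrable:
  assumes "copula C" "v \<in> {0..1}"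
  shows "(\<lambda>u. C u v - u * v) integrable_on {0..1}"
  using assms
  by (intro integrable_diff integrable_on_mono_on copula_mono_on integrable_continuous_real
      continuous_intros)

text \<open>Integrability is assumed instead of \<open>copula C\<close>, so that the lemma applies
  to mixtures without proving that they are copulas.\<close>

lemma PQD_imp_PQDE:
  assumes "\<And>v. v \<in> {0..1} \<Longrightarrow> (\<lambda>u. C u v - u * v) integrable_on {0..1}" and "PQD C"
  shows "PQDE C"
  unfolding PQDE_def mean_excess_def
  using assms by (auto simp: PQD_def intro!: integral_nonneg)

lemma NQD_imp_NQDE:
  assumes "\<And>v. v \<in> {0..1} \<Longrightarrow> (\<lambda>u. C u v - u * v) integrable_on {0..1}" and "NQD C"
  shows "NQDE C"
proof -
  have "integral {0..1} (\<lambda>u. C u v - u * v) \<le> integral {0..1} (\<lambda>u::real. 0::real)"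
    if "v \<in> {0..1}" for v
    by (rule integral_le) (use assms that in \<open>auto simp: NQD_def\<close>)
  then show ?thesis by (simp add: NQDE_def mean_excess_def)
qed

lemma mix_excess_eq:
  "mix C0 C1 t u v - u * v = (1 - t) * (C0 u v - u * v) + t * (C1 u v - u * v)"
  by (simp add: mix_def algebra_simps)

lemma mix_excess_integrable:
  assumes "copula C0" "copula C1" "v \<in> {0..1}"
  shows "(\<lambda>u. mix C0 C1 t u v - u * v) integrable_on {0..1}"
  unfolding mix_excess_eq using assms
  by (intro integrable_add integrable_on_mult_right copula_excess_integrable)

lemma mean_excess_mix:
  assumes "copula C0" "copula C1" "v \<in> {0..1}"
  shows "mean_excess (mix C0 C1 t) v = (1 - t) * mean_excess C0 v + t * mean_excess C1 v"
  unfolding mean_excess_def mix_excess_eq using assms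
  by (simp add: integral_add integrable_on_mult_right copula_excess_integrable)

text \<open>Isolating \<open>t\<close> gives constraints of the shape treated by the half-space
  lemmas, indexed by the points of the square. Their two sides carry the denominator and the
  numerator of the quotient in the theorem.\<close>

lemma NQD_mix_iff:
  "NQD (mix C0 C1 t) \<longleftrightarrow>
    (\<forall>(u, v)\<in>{0..1} \<times> {0..1}. t * (C1 u v - C0 u v) \<le> u * v - C0 u v)"
  unfolding NQD_def mix_def by (simp add: algebra_simps)

lemma PQD_mix_iff:
  "PQD (mix C0 C1 t) \<longleftrightarrow>
    (\<forall>(u, v)\<in>{0..1} \<times> {0..1}. u * v - C0 u v \<le> t * (C1 u v - C0 u v))"
  unfolding PQD_def mix_def by (simp add: algebra_simps)

text \<open>Since \<open>mean_excess\<close> is affine along the mixture, the same rearrangement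
  works with \<open>v\<close> alone as index.\<close>

lemma NQDE_mix_iff:
  assumes "copula C0" "copula C1"
  shows "NQDE (mix C0 C1 t) \<longleftrightarrow>
    (\<forall>v\<in>{0..1}. t * (mean_excess C1 v - mean_excess C0 v) \<le> - mean_excess C0 v)"
  unfolding NQDE_def using assms
  by (intro ball_cong refl) (simp add: mean_excess_mix algebra_simps)

lemma PQDE_mix_iff:
  assumes "copula C0" "copula C1"
  shows "PQDE (mix C0 C1 t) \<longleftrightarrow>
    (\<forall>v\<in>{0..1}. - mean_excess C0 v \<le> t * (mean_excess C1 v - mean_excess C0 v))"
  unfolding PQDE_def using assms
  by (intro ball_cong refl) (simp add: mean_excess_mix algebra_simps)

theorem theorem3p1:
  fixes C0 C1 :: "real \<Rightarrow> real \<Rightarrow> real"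
  assumes "copula C0" and "copula C1"
    and "NQD C0" and "PQD C1"
    and "\<not> (\<lambda>(u, v). (u * v - C0 u v) / (C1 u v - C0 u v)) constant_on
             {(u, v). u \<in> {0..1} \<and> v \<in> {0..1} \<and> C1 u v \<noteq> C0 u v}"
  shows "\<exists>m\<in>{0..1}. \<exists>m'\<in>{0..1}. \<exists>M'\<in>{0..1}. \<exists>M\<in>{0..1}.
           0 \<le> m \<and> m \<le> m' \<and> M' \<le> M \<and> M \<le> 1 \<and> m < M \<and>
           (\<forall>\<alpha>\<in>{0..m}. NQD (mix C0 C1 \<alpha>)) \<and>
           (\<forall>\<alpha>\<in>{m<..<M}. \<not> NQD (mix C0 C1 \<alpha>) \<and> \<not> PQD (mix C0 C1 \<alpha>)) \<and>
           (\<forall>\<alpha>\<in>{M..1}. PQD (mix C0 C1 \<alpha>)) \<and>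
           (\<forall>\<alpha>\<in>{0..1}. NQDE (mix C0 C1 \<alpha>) \<longleftrightarrow> \<alpha> \<in> {0..m'}) \<and>
           (\<forall>\<alpha>\<in>{m'<..<M'}. \<not> NQDE (mix C0 C1 \<alpha>) \<and> \<not> PQDE (mix C0 C1 \<alpha>)) \<and>
           (\<forall>\<alpha>\<in>{0..1}. PQDE (mix C0 C1 \<alpha>) \<longleftrightarrow> \<alpha> \<in> {M'..1})"
proof -
  define d where "d = (\<lambda>(u, v). C1 u v - C0 u v)"
  define f where "f = (\<lambda>(u, v). u * v - C0 u v)"
  define Q :: "(real \<times> real) set" where "Q = {0..1} \<times> {0..1}"
  have NQD: "NQD (mix C0 C1 t) \<longleftrightarrow> (\<forall>p\<in>Q. t * d p \<le> f p)" for t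
    by (simp add: NQD_mix_iff d_def f_def Q_def split: prod.splits)
  have PQD: "PQD (mix C0 C1 t) \<longleftrightarrow> (\<forall>p\<in>Q. f p \<le> t * d p)" for t
    by (simp add: PQD_mix_iff d_def f_def Q_def split: prod.splits)
  \<comment> \<open>These bounds say that \<open>t = 0\<close> satisfies all NQD constraints and
    \<open>t = 1\<close> all PQD constraints.\<close>
  have f0: "0 \<le> f p" and fd: "f p \<le> d p" if "p \<in> Q" for p
    using assms(3,4) that by (auto simp: NQD_def PQD_def d_def f_def Q_def)
  obtain m where m: "m \<in> {0..1}" "\<And>t. t \<in> {0..1} \<Longrightarrow> NQD (mix C0 C1 t) \<longleftrightarrow> t \<in> {0..m}"
    unfolding NQD using halfspaces_Icc_from_0[of Q f d] f0 by blast
  obtain M where M: "M \<in> {0..1}" "\<And>t. t \<in> {0..1} \<Longrightarrow> PQD (mix C0 C1 t) \<longleftrightarrow> t \<in> {M..1}"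
    unfolding PQD using halfspaces_Icc_to_1[of Q f d] fd by blast

  have E0: "mean_excess C0 v \<le> 0" and E1: "0 \<le> mean_excess C1 v" if "v \<in> {0..1}" for v
    using NQD_imp_NQDE[of C0] PQD_imp_PQDE[of C1] copula_excess_integrable assms that
    by (auto simp: NQDE_def PQDE_def)
  obtain m' where m': "m' \<in> {0..1}" "\<And>t. t \<in> {0..1} \<Longrightarrow> NQDE (mix C0 C1 t) \<longleftrightarrow> t \<in> {0..m'}"
    unfolding NQDE_mix_iff[OF assms(1,2)]
    using halfspaces_Icc_from_0[of "{0..1}" "\<lambda>v. - mean_excess C0 v"
        "\<lambda>v. mean_excess C1 v - mean_excess C0 v"] E0 by auto
  obtain M' where M': "M' \<in> {0..1}" "\<And>t. t \<in> {0..1} \<Longrightarrow> PQDE (mix C0 C1 t) \<longleftrightarrow> t \<in> {M'..1}"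
    unfolding PQDE_mix_iff[OF assms(1,2)]
    using halfspaces_Icc_to_1[of "{0..1}" "\<lambda>v. - mean_excess C0 v"
        "\<lambda>v. mean_excess C1 v - mean_excess C0 v"] E1 by auto

  \<comment> \<open>At the endpoint \<open>m\<close> itself the mixture is NQD, hence NQDE, so
    \<open>m\<close> lies in \<open>{0..m'}\<close>. The bound on \<open>M'\<close> is dual.\<close>
  have "m \<le> m'"
    using NQD_imp_NQDE[of "mix C0 C1 m"] mix_excess_integrable assms(1,2) m m' by auto
  moreover have "M' \<le> M"
    using PQD_imp_PQDE[of "mix C0 C1 M"] mix_excess_integrable assms(1,2) M M' by auto
  moreover have "m < M"
  proof (rule ccontr)
    assume "\<not> m < M"
    \<comment> \<open>If \<open>M \<le> m\<close>, then
      \<open>m * d p \<le> f p \<le> M * d p \<le> m * d p\<close>, where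
      \<open>0 \<le> f p \<le> d p\<close> and \<open>d p \<noteq> 0\<close> give
      \<open>d p > 0\<close>. The quotient would then be constantly \<open>m\<close>.\<close>
    have quotient: "f p / d p = m" if p: "p \<in> Q" "d p \<noteq> 0" for p
    proof -
      have "d p > 0" using f0[OF p(1)] fd[OF p(1)] p(2) by linarith
      moreover have "m * d p \<le> f p" using m NQD p by auto
      moreover have "f p \<le> M * d p" using M PQD p by auto
      moreover have "M * d p \<le> m * d p"
        using \<open>\<not> m < M\<close> \<open>d p > 0\<close> by (intro mult_right_mono) auto
      ultimately have "f p = m * d p" by linarith
      with \<open>d p > 0\<close> show ?thesis by simp
    qed
    have "(\<lambda>(u, v). (u * v - C0 u v) / (C1 u v - C0 u v)) constant_on
        {(u, v). u \<in> {0..1} \<and> v \<in> {0..1} \<and> C1 u v \<noteq> C0 u v}"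
      unfolding constant_on_def
    proof (intro exI ballI)
      fix p assume p: "p \<in> {(u, v). u \<in> {0..1} \<and> v \<in> {0..1} \<and> C1 u v \<noteq> C0 u v}"
      then have "p \<in> Q" "d p \<noteq> 0" by (simp_all add: Q_def d_def split_beta mem_Times_iff)
      then have "f p / d p = m" by (rule quotient)
      then show "(case p of (u, v) \<Rightarrow> (u * v - C0 u v) / (C1 u v - C0 u v)) = m"
        by (simp add: f_def d_def split_beta)
    qed
    with assms(5) show False by contradiction
  qed
  moreover have "NQD (mix C0 C1 t)" if "t \<in> {0..m}" for t
    using m that by simp
  moreover have "PQD (mix C0 C1 t)" if "t \<in> {M..1}" for t
    using M that by simp
  moreover have "\<not> NQD (mix C0 C1 t) \<and> \<not> PQD (mix C0 C1 t)" if "t \<in> {m<..<M}" for t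
    using m(1) m(2)[of t] M(1) M(2)[of t] that by simp
  \<comment> \<open>For \<open>M' \<le> m'\<close> there is no such \<open>t\<close> and the claim
    is vacuous; otherwise \<open>t\<close> lies in \<open>{0..1}\<close> and both equivalences
    apply.\<close>
  moreover have "\<not> NQDE (mix C0 C1 t) \<and> \<not> PQDE (mix C0 C1 t)" if "t \<in> {m'<..<M'}" for t
    using m'(1) m'(2)[of t] M'(1) M'(2)[of t] that by simp
  moreover have "0 \<le> m" "M \<le> 1"
    using m(1) M(1) by simp_all
  ultimately have *: "0 \<le> m \<and> m \<le> m' \<and> M' \<le> M \<and> M \<le> 1 \<and> m < M \<and>
      (\<forall>\<alpha>\<in>{0..m}. NQD (mix C0 C1 \<alpha>)) \<and>
      (\<forall>\<alpha>\<in>{m<..<M}. \<not> NQD (mix C0 C1 \<alpha>) \<and> \<not> PQD (mix C0 C1 \<alpha>)) \<and>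
      (\<forall>\<alpha>\<in>{M..1}. PQD (mix C0 C1 \<alpha>)) \<and>
      (\<forall>\<alpha>\<in>{0..1}. NQDE (mix C0 C1 \<alpha>) \<longleftrightarrow> \<alpha> \<in> {0..m'}) \<and>
      (\<forall>\<alpha>\<in>{m'<..<M'}. \<not> NQDE (mix C0 C1 \<alpha>) \<and> \<not> PQDE (mix C0 C1 \<alpha>)) \<and>
      (\<forall>\<alpha>\<in>{0..1}. PQDE (mix C0 C1 \<alpha>) \<longleftrightarrow> \<alpha> \<in> {M'..1})"
    using m'(2) M'(2) by blast
  show ?thesis
    by (rule bexI[OF _ m(1)], rule bexI[OF _ m'(1)], rule bexI[OF _ M'(1)], rule bexI[OF _ M(1)])
      (rule *)
qed

end
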